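(* Let $n\ge3$, $0<k<n-2$, let $Q_k>0$ be the constant fixed in the context, and let $g:\mathbb{R}^n\times\mathbb{R}\times\mathbb{R}^n\to\mathbb{R}$, $g=g(x,z,p)$, satisfy: (H1) for every $x\in\mathbb{R}^n$, $g(x,\cdot,\cdot)\in C^1\big((\mathbb{R}\times\mathbb{R}^n)\setminus\{(0,0)\}\big)\cap C(\mathbb{R}\times\mathbb{R}^n)$; (H2) the function $x\mapsto g(x,0,0)$ belongs to $E_{k+2}$; (H3) there exists $\delta>0$ such that $\sup_{0<\|w\|_{F_k}\le\delta}\|D_{(z,p)}g(\cdot,w,Dw)\|_{E_2}<\infty$. Suppose $\varepsilon>0$ is such that $\sup_{0<\|w\|_{F_k}\le\varepsilon}\|D_{(z,p)}g(\cdot,w,Dw)\|_{E_2}<Q_k$ and $\|g(\cdot,0,0)\|_{E_{k+2}}\le\varepsilon Q_k$. Let $u$ be the unique function in $F_k$ with $\|u\|_{F_k}\le\varepsilon$ satisfying $$u(x)=\frac{1}{(n-2)\omega_n}\int_{\mathbb{R}^n}\frac{1}{|x-y|^{n-2}}\,g(y,u(y),Du(y))\,dy\quad\text{for all }x\in\mathbb{R}^n .$$ Let $\mathcal{G}$ be a subset of the orthogonal group $\mathcal{O}(n)$. Then: (A) if $g$ is symmetric in $x$ and $p$ under the action of $\mathcal{G}$, then $u$ is symmetric under $\mathcal{G}$; (B) if $g$ is antisymmetric in $p$ under the action of $\mathcal{G}$, then $u\equiv0$; (C) if $g$ is antisymmetric in $x$ under the action of $\mathcal{G}$, even in $z$ (i.e.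 $g(x,z,p)=g(x,-z,p)$ for all $x,z,p$), and symmetric in $p$ under the action of $\mathcal{G}$, then $u$ is antisymmetric under $\mathcal{G}$.
   Context: $\omega_n$ is the area of the unit sphere in $\mathbb{R}^n$. For $k\in\mathbb{R}$, $E_k$ is the Banach space of measurable functions $u$ on $\mathbb{R}^n$ with $\|u\|_{E_k}=\operatorname{ess\,sup}_{x\in\mathbb{R}^n}(1+|x|)^k|u(x)|<\infty$ (for vector-valued functions, $|\cdot|$ is the Euclidean norm). $F_k$ is the Banach space of $u\in C^1(\mathbb{R}^n)$ with $\|u\|_{F_k}=\sup_{x\in\mathbb{R}^n}(1+|x|)^k(|u(x)|+|Du(x)|)<\infty$. $D_{(z,p)}g(x,z,p)\in\mathbb{R}^{n+1}$ denotes the gradient of $g$ with respect to the last $n+1$ variables $(z,p)$, and $D_{(z,p)}g(\cdot,w,Dw)$ is the function $x\mapsto D_{(z,p)}g(x,w(x),Dw(x))$. The suprema are over $w\in F_k$ with the indicated norm bounds; since $g(x,\cdot,\cdot)$ need not be differentiable at $(0,0)$, the norm $\|D_{(z,p)}g(\cdot,w,Dw)\|_{E_2}$ is computed over those $x$ with $(w(x),Dw(x))\ne(0,0)$. The finiteness of these norms includes the requirement that the functions involved are measurable. The constant $Q_k$: for $0<k<n-2$ there is a constant $C_k>0$ such that $\|N(f)\|_{F_k}\le C_k\|f\|_{E_{k+2}}$ for all $f\in E_{k+2}$, where $N(f)(x)=\frac{1}{(n-2)\omega_n}\int_{\mathbb{R}^n}|x-y|^{2-n}f(y)\,dy$. Fix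 such a $C_k$ and set $Q_k=\frac{1}{2C_k}$. Under the stated hypotheses on $g$ and $\varepsilon$, the integral equation has exactly one solution $u\in F_k$ with $\|u\|_{F_k}\le\varepsilon$. A function $u$ on $\mathbb{R}^n$ is symmetric under (the action of) $\mathcal{G}$ if $u(x)=u(Tx)$ for all $T\in\mathcal{G}$ and $x\in\mathbb{R}^n$, and antisymmetric under $\mathcal{G}$ if $u(x)=-u(Tx)$ for all $T\in\mathcal{G}$ and $x\in\mathbb{R}^n$. Correspondingly, $g$ is symmetric (resp. antisymmetric) in $x$ if $g(Tx,z,p)=g(x,z,p)$ (resp. $g(Tx,z,p)=-g(x,z,p)$), and symmetric (resp. antisymmetric) in $p$ if $g(x,z,Tp)=g(x,z,p)$ (resp. $g(x,z,Tp)=-g(x,z,p)$), for all $T\in\mathcal{G}$ and all $(x,z,p)$.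
   Formalization: Part (C) additionally assumes g is even in p, g(x,z,p)=g(x,z,-p), as (C) fails otherwise (e.g. g=η(x)(1+p_2), η small, compactly supported and odd in x_1, reflection in x_1); part (B) assumes G is nonempty, since for empty G its hypothesis is vacuous. *)

theory Defs
  imports "HOL-Probability.Essential_Supremum"
begin

definition gradient :: "('a::real_inner \<Rightarrow> real) \<Rightarrow> 'a \<Rightarrow> 'a" where
  "gradient f x = (THE D. GDERIV f x :> D)"

lemma gradient_eqI:
  fixes f :: "'a::real_inner \<Rightarrow> real"
  assumes "GDERIV f x :> D"
  shows "gradient f x = D"
  unfolding gradient_def
proof (rule the_equality)
  fix E assume "GDERIV f x :> E"
  with assms have "(\<lambda>h. h \<bullet> E) = (\<lambda>h. h \<bullet> D)"
    unfolding gderiv_def by (rule has_derivative_unique[rotated])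
  then have "(E - D) \<bullet> E = (E - D) \<bullet> D" by (rule fun_cong)
  then have "(E - D) \<bullet> (E - D) = 0" by (simp add: inner_diff_right)
  then show "E = D" by simp
qed (rule assms)

text \<open>Used for open \<open>S\<close> only.\<close>

definition C1_on :: "'a::real_inner set \<Rightarrow> ('a \<Rightarrow> real) \<Rightarrow> bool" where
  "C1_on S f \<longleftrightarrow> (\<exists>D. (\<forall>x\<in>S. GDERIV f x :> D x) \<and> continuous_on S D)"

text \<open>The norm of \<open>E\<^sub>k\<close>, with the essential supremum taken over a measurable set \<open>S\<close>
  of positive measure. It is infinite if \<open>u\<close> is not Lebesgue measurable on \<open>S\<close>.\<close>

definition E_norm_on ::
    "(real^'n) set \<Rightarrow> real \<Rightarrow> (real^'n \<Rightarrow> 'b::real_normed_vector) \<Rightarrow> ennreal" where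
  "E_norm_on S k u =
     (if u \<in> borel_measurable (lebesgue_on S)
      then esssup (lebesgue_on S) (\<lambda>x. ennreal ((1 + norm x) powr k * norm (u x)))
      else \<infinity>)"

definition E_norm :: "real \<Rightarrow> (real^'n \<Rightarrow> 'b::real_normed_vector) \<Rightarrow> ennreal" where
  "E_norm k u = E_norm_on UNIV k u"

definition E_space :: "real \<Rightarrow> (real^'n \<Rightarrow> real) set" where
  "E_space k = {u. E_norm k u < \<infinity>}"

text \<open>The norm of \<open>F\<^sub>k\<close>, infinite on functions that are not continuously differentiable.\<close>

definition F_norm :: "real \<Rightarrow> (real^'n \<Rightarrow> real) \<Rightarrow> ennreal" where
  "F_norm k u =
     (if C1_on UNIV u
      then (SUP x. ennreal ((1 + norm x) powr k * (norm (u x) + norm (gradient u x))))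
      else \<infinity>)"

definition F_space :: "real \<Rightarrow> (real^'n \<Rightarrow> real) set" where
  "F_space k = {u. F_norm k u < \<infinity>}"

text \<open>Surface measure on the unit sphere, as \<open>n\<close> times the volume of the cone over \<open>A\<close>.\<close>

definition sphere_area :: "(real^'n) set \<Rightarrow> real" where
  "sphere_area A = real CARD('n) * measure lebesgue {r *\<^sub>R x | r x. 0 < r \<and> r \<le> 1 \<and> x \<in> A}"

lemma sphere_area_unit_sphere:
  "sphere_area (sphere (0::real^'n) 1) = 2 * pi powr (CARD('n) / 2) / Gamma (CARD('n) / 2)"
proof -
  let ?n = "real CARD('n)"
  have cone: "{r *\<^sub>R x | r x. 0 < r \<and> r \<le> 1 \<and> x \<in> sphere (0::real^'n) 1} = cball 0 1 - {0}"
    (is "?L = ?R")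
  proof
    show "?L \<subseteq> ?R" by (auto simp: abs_if)
    show "?R \<subseteq> ?L"
    proof
      fix y :: "real^'n" assume y: "y \<in> ?R"
      then have "y = norm y *\<^sub>R sgn y" "0 < norm y" "norm y \<le> 1" "sgn y \<in> sphere 0 1"
        by (auto simp: sgn_div_norm)
      then show "y \<in> ?L" by blast
    qed
  qed
  have "measure lebesgue (cball (0::real^'n) 1 - {0}) = measure lebesgue (cball (0::real^'n) 1)"
    by (intro measure_Diff_null_set) auto
  also have "\<dots> = unit_ball_vol ?n"
    using content_cball[of 1 "0::real^'n"] by (simp add: measure_completion)
  finally have "sphere_area (sphere (0::real^'n) 1) = ?n * unit_ball_vol ?n"
    unfolding sphere_area_def cone by simp
  also have "\<dots> = 2 * pi powr (?n / 2) / Gamma (?n / 2)"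
  proof -
    have pos: "?n / 2 > 0" by simp
    then have "?n / 2 \<notin> \<int>\<^sub>\<le>\<^sub>0" using nonpos_Ints_nonpos[of "?n / 2"] by linarith
    from Gamma_plus1[OF this] have "Gamma (?n / 2 + 1) = ?n / 2 * Gamma (?n / 2)" .
    then have "unit_ball_vol ?n = pi powr (?n / 2) / (?n / 2 * Gamma (?n / 2))"
      unfolding unit_ball_vol_def by (simp only:)
    then show ?thesis by simp
  qed
  finally show ?thesis .
qed

definition newton_potential :: "(real^'n \<Rightarrow> real) \<Rightarrow> real^'n \<Rightarrow> real" where
  "newton_potential f x =
     1 / ((real CARD('n) - 2) * sphere_area (sphere (0::real^'n) 1)) *
     (LINT y|lebesgue. norm (x - y) powr (2 - real CARD('n)) * f y)"

definition grad_zp ::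
    "(real^'n \<Rightarrow> real \<Rightarrow> real^'n \<Rightarrow> real) \<Rightarrow> real^'n \<Rightarrow> real \<Rightarrow> real^'n \<Rightarrow> real \<times> (real^'n)" where
  "grad_zp g x z p = gradient (\<lambda>(z, p). g x z p) (z, p)"

text \<open>The set excludes the points \<open>x\<close> with \<open>(w x, Dw x) = (0, 0)\<close>, where \<open>g x\<close> need not be
  differentiable. It is open and, for \<open>w\<close> other than \<open>0\<close>, nonempty.\<close>

definition grad_zp_sup ::
    "real \<Rightarrow> (real^'n \<Rightarrow> real \<Rightarrow> real^'n \<Rightarrow> real) \<Rightarrow> real \<Rightarrow> ennreal" where
  "grad_zp_sup k g r =
     (SUP w \<in> {w \<in> F_space k. 0 < F_norm k w \<and> F_norm k w \<le> ennreal r}.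
        E_norm_on {x. (w x, gradient w x) \<noteq> (0, 0)} 2
          (\<lambda>x. grad_zp g x (w x) (gradient w x)))"

end

theory Submission
  imports Defs
begin

text \<open>The map \<open>w \<mapsto> N (g (\<cdot>, w, Dw))\<close> is a contraction on the \<open>\<epsilon>\<close>-ball of
  \<open>F\<^sub>k\<close>, so it has at most one fixed point there. If \<open>T\<close> is orthogonal, then under the
  hypotheses of (A) and (C) the functions \<open>u \<circ> T\<close> and \<open>- u \<circ> T\<close>,
  respectively, are fixed points in the same ball, because \<open>N\<close> commutes with isometries and
  \<open>D(u \<circ> T) = T\<inverse> (Du \<circ> T)\<close>; hence they equal \<open>u\<close>. In (B) the
  antisymmetry gives \<open>g (x, 0, 0) = 0\<close>, so \<open>0\<close> is a fixed point.\<close>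

text \<open>Three obstacles shape the proof. The bound on \<open>grad_zp\<close> holds only almost
  everywhere, with an exceptional set depending on w, whereas comparing two solutions at a point x
  needs it along the whole segment joining their values and gradients; it is used at rational
  parameters and extended by continuity. That segment may cross (0, 0), where g(x, ., .) need not be
  differentiable; for distinct endpoints this happens at one parameter at most, and continuity
  bridges it. Finally, measurability of y -> g(y, u(y), Du(y)) is not among the hypotheses and the
  Bochner integral is total, so measurability of the source and integrability of kernel times source
  must be established before linearity or a change of variables applies.

  The constant Q = 1 / (2 C) makes the contraction constant smaller than 1/2, while the bound
  \<epsilon> Q on g(., 0, 0) gives its potential norm at most \<epsilon> / 2; together they keep the
  map inside the ball.\<close>

section \<open>Isometries and Lebesgue measure\<close>

text \<open>The change of variables theorems of HOL-Analysis require an index type of class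
  \<open>wellorder\<close>. Here a Vitali packing of an open set by balls gives the invariance of Lebesgue
  measure under isometries directly.\<close>

lemma emeasure_open_le_orthogonal_image:
  fixes T :: "'a::euclidean_space \<Rightarrow> 'a"
  assumes T: "orthogonal_transformation T" and S: "open S"
  shows "emeasure lborel S \<le> emeasure lborel (T ` S)"
proof -
  define K where "K = {(a, r). 0 < r \<and> ball a r \<subseteq> S}"
  have cover: "\<exists>i. i \<in> K \<and> x \<in> ball (fst i) (snd i) \<and> snd i < d" if "x \<in> S" "0 < d" for x and d :: real
  proof -
    obtain e where e: "e > 0" "ball x e \<subseteq> S" using S \<open>x \<in> S\<close> open_contains_ball by blast
    then have "(x, min e (d / 2)) \<in> K" using \<open>0 < d\<close> by (auto simp: K_def)
    then show ?thesis using e \<open>0 < d\<close> by (intro exI[of _ "(x, min e (d / 2))"]) auto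
  qed
  obtain I where I: "countable I" "I \<subseteq> K"
    "pairwise (\<lambda>i j. disjnt (ball (fst i) (snd i)) (ball (fst j) (snd j))) I"
    "negligible (S - (\<Union>i\<in>I. ball (fst i) (snd i)))"
    by (rule Vitali_covering_theorem_balls[OF cover])
  define B where "B i = ball (fst i) (snd i)" for i :: "'a \<times> real"
  have imB: "T ` B i = ball (T (fst i)) (snd i)" for i
    unfolding B_def using T by (rule image_orthogonal_transformation_ball)
  have disj: "disjoint_family_on B I"
    using I(3) by (auto simp: disjoint_family_on_def pairwise_def disjnt_def B_def)
  have disj': "disjoint_family_on (\<lambda>i. T ` B i) I"
    using disj orthogonal_transformation_inj[OF T]
    unfolding disjoint_family_on_def by (metis image_Int image_empty)
  \<comment> \<open>\<open>negligible\<close> refers to the completed measure; the set is Borel, so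
    it is null for \<open>lborel\<close> as well.\<close>
  have null: "S - (\<Union>i\<in>I. B i) \<in> null_sets lborel"
  proof -
    have "S - (\<Union>i\<in>I. B i) \<in> sets lborel"
      using S I(1) by (intro sets.Diff) (auto simp: B_def intro!: borel_open)
    moreover have "S - (\<Union>i\<in>I. B i) \<in> null_sets lebesgue"
      using I(4) by (simp add: B_def negligible_iff_null_sets)
    ultimately show ?thesis by (simp add: null_sets_completion_iff)
  qed
  have sub: "(\<Union>i\<in>I. B i) \<subseteq> S"
    using I(2) unfolding B_def K_def by fastforce
  have "S = (\<Union>i\<in>I. B i) \<union> (S - (\<Union>i\<in>I. B i))" using sub by auto
  then have "emeasure lborel S = emeasure lborel ((\<Union>i\<in>I. B i) \<union> (S - (\<Union>i\<in>I. B i)))"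
    by simp
  also have "\<dots> = emeasure lborel (\<Union>i\<in>I. B i)"
    using null by (intro emeasure_Un_null_set) (auto simp: B_def intro!: borel_open open_UN)
  also have "\<dots> = (\<integral>\<^sup>+i. emeasure lborel (B i) \<partial>count_space I)"
    using I(1) disj by (intro emeasure_UN_countable) (auto simp: B_def [abs_def])
  also have "\<dots> = (\<integral>\<^sup>+i. emeasure lborel (T ` B i) \<partial>count_space I)"
  proof (rule nn_integral_cong)
    fix i assume "i \<in> space (count_space I)"
    then have "0 < snd i" using I(2) by (auto simp: K_def)
    then show "emeasure lborel (B i) = emeasure lborel (T ` B i)"
      unfolding imB by (simp add: B_def emeasure_ball)
  qed
  also have "\<dots> = emeasure lborel (\<Union>i\<in>I. T ` B i)"
    using I(1) disj' by (intro emeasure_UN_countable[symmetric]) (auto simp: imB)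
  also have "\<dots> \<le> emeasure lborel (T ` S)"
  proof (rule emeasure_mono)
    show "(\<Union>i\<in>I. T ` B i) \<subseteq> T ` S" using sub by blast
    have "open (T ` S)"
      using T S by (metis open_surjective_linear_image orthogonal_transformation_linear orthogonal_transformation_surj)
    then show "T ` S \<in> sets lborel" by simp
  qed
  finally show ?thesis .
qed

lemma distr_lborel_orthogonal:
  fixes T :: "'a::euclidean_space \<Rightarrow> 'a"
  assumes T: "orthogonal_transformation T"
  shows "distr lborel borel T = lborel"
proof (rule lborel_eqI[symmetric])
  let ?S = "inv T"
  have bij: "bij T" using T by (rule orthogonal_transformation_bij)
  have S: "orthogonal_transformation ?S" using T by (rule orthogonal_transformation_inv)
  have cont: "continuous_on UNIV T"
    using T linear_continuous_on linear_linear orthogonal_transformation_linear by blast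
  have contS: "open (?S ` A)" if "open A" for A
    using S that by (metis open_surjective_linear_image orthogonal_transformation_linear orthogonal_transformation_surj)
  fix l u :: 'a assume lu: "\<And>b. b \<in> Basis \<Longrightarrow> l \<bullet> b \<le> u \<bullet> b"
  have "emeasure (distr lborel borel T) (box l u) = emeasure lborel (?S ` box l u)"
    using cont bij by (subst emeasure_distr) (auto simp: bij_vimage_eq_inv_image intro: borel_measurable_continuous_onI)
  also have "\<dots> = emeasure lborel (box l u)"
  \<comment> \<open>The open-set inequality is applied to \<open>T\<close> and to its inverse, one
    for each direction.\<close>
  proof (rule antisym)
    have "T ` ?S ` box l u = box l u"
      using bij by (simp add: image_f_inv_f bij_is_surj)
    then show "emeasure lborel (?S ` box l u) \<le> emeasure lborel (box l u)"
      using emeasure_open_le_orthogonal_image[OF T contS[OF open_box]] by metis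
  qed (rule emeasure_open_le_orthogonal_image[OF S open_box])
  also have "\<dots> = (\<Prod>b\<in>Basis. (u - l) \<bullet> b)" using lu by (simp add: emeasure_lborel_box_eq)
  finally show "emeasure (distr lborel borel T) (box l u) = (\<Prod>b\<in>Basis. (u - l) \<bullet> b)" .
qed simp

text \<open>Since \<open>T\<close> preserves \<open>lborel\<close>, preimages of Borel null sets are
  null, and both claims pass to the completion.\<close>

lemma
  fixes T :: "'a::euclidean_space \<Rightarrow> 'a"
  assumes T: "orthogonal_transformation T"
  shows lebesgue_measurable_orthogonal: "T \<in> lebesgue \<rightarrow>\<^sub>M lebesgue"
    and distr_lebesgue_orthogonal: "distr lebesgue lebesgue T = lebesgue"
proof -
  have T_borel [measurable]: "T \<in> borel \<rightarrow>\<^sub>M borel"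
    using T by (intro borel_measurable_continuous_onI linear_continuous_on)
      (simp add: linear_linear orthogonal_transformation_linear)
  have eq: "distr lebesgue lborel T = lborel"
    using distr_lborel_orthogonal[OF T] by (simp add: distr_completion cong: distr_cong)
  show "T \<in> lebesgue \<rightarrow>\<^sub>M lebesgue"
    by (intro completion.measurable_completion2) (simp_all add: eq measurable_completion)
  have "distr lebesgue lebesgue T = completion (distr lebesgue lborel T)"
    by (subst completion.completion_distr_eq) (auto simp: eq measurable_completion)
  then show "distr lebesgue lebesgue T = lebesgue" by (simp add: eq)
qed

section \<open>Integrability of the Newton kernel\<close>

text \<open>Dyadic shells around x: on the shell of exponent \<open>i j\<close> the integrand is at
  most its value at the inner radius, and the shell lies in the ball of twice that radius. It
  therefore contributes at most a constant times 2 to the power (DIM - s) \<open>i j\<close>.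
  Choosing \<open>i\<close> decreasing or increasing treats the singularity at x and the decay at
  infinity alike.\<close>

lemma nn_integral_powr_shells_finite:
  fixes x :: "'a::euclidean_space" and i :: "nat \<Rightarrow> int" and s :: real
  assumes s: "0 \<le> s"
    and summable: "summable (\<lambda>j. 2 powr ((DIM('a) - s) * i j))"
    and shells: "\<And>y. y \<in> A \<Longrightarrow> \<exists>j. 2 powr i j \<le> dist x y \<and> dist x y < 2 powr (real_of_int (i j) + 1)"
  shows "(\<integral>\<^sup>+y. ennreal (dist x y powr (- s)) * indicator A y \<partial>lborel) < \<infinity>"
proof -
  define c where "c j = (2 powr i j) powr (- s)" for j
  define B where "B j = cball x (2 powr (real_of_int (i j) + 1))" for j
  let ?V = "unit_ball_vol DIM('a)"
  have "(\<integral>\<^sup>+y. ennreal (dist x y powr (- s)) * indicator A y \<partial>lborel)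
      \<le> (\<integral>\<^sup>+y. (\<Sum>j. ennreal (c j) * indicator (B j) y) \<partial>lborel)"
  proof (rule nn_integral_mono)
    fix y
    show "ennreal (dist x y powr (- s)) * indicator A y \<le> (\<Sum>j. ennreal (c j) * indicator (B j) y)"
    proof (cases "y \<in> A")
      case True
      then obtain j where j: "2 powr i j \<le> dist x y" "dist x y < 2 powr (real_of_int (i j) + 1)"
        using shells by blast
      have "dist x y powr (- s) \<le> c j"
        unfolding c_def using s j by (intro powr_mono2') auto
      then have "ennreal (dist x y powr (- s)) * indicator A y \<le> ennreal (c j) * indicator (B j) y"
        using j True by (simp add: B_def ennreal_leI)
      also have "\<dots> \<le> (\<Sum>j. ennreal (c j) * indicator (B j) y)"
        using sum_le_suminf[of "\<lambda>j. ennreal (c j) * indicator (B j) y" "{j}"]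
        by (simp del: sum_mult_indicator)
      finally show ?thesis .
    qed simp
  qed
  also have "\<dots> = (\<Sum>j. ennreal (c j) * emeasure lborel (B j))"
    by (subst nn_integral_suminf)
      (auto simp: B_def nn_integral_cmult_indicator
        intro!: borel_measurable_times_ennreal borel_measurable_indicator)
  also have "\<dots> = (\<Sum>j. ennreal (?V * 2 ^ DIM('a) * 2 powr ((DIM('a) - s) * i j)))"
  proof (intro suminf_cong)
    fix j
    have "c j * (2 powr (real_of_int (i j) + 1)) ^ DIM('a) = 2 ^ DIM('a) * 2 powr ((DIM('a) - s) * i j)"
      by (simp add: c_def powr_powr powr_power powr_add [symmetric] powr_realpow [symmetric] algebra_simps)
    then show "ennreal (c j) * emeasure lborel (B j) = ennreal (?V * 2 ^ DIM('a) * 2 powr ((DIM('a) - s) * i j))"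
      by (simp add: B_def emeasure_cball ennreal_mult[symmetric] c_def mult_ac)
  qed
  also have "\<dots> = ennreal (\<Sum>j. ?V * 2 ^ DIM('a) * 2 powr ((DIM('a) - s) * i j))"
    by (intro suminf_ennreal2 summable_mult summable) simp
  finally show ?thesis by (simp add: le_less_trans[OF _ ennreal_less_top])
qed

lemma two_powr_shell:
  assumes "0 < r"
  shows "2 powr \<lfloor>log 2 r\<rfloor> \<le> r" "r < 2 powr (real_of_int \<lfloor>log 2 r\<rfloor> + 1)"
  using assms by (auto simp: powr_le_iff less_powr_iff)

lemma nn_integral_powr_near_finite:
  fixes x :: "'a::euclidean_space" and s :: real
  assumes s: "0 \<le> s" "s < DIM('a)"
  shows "(\<integral>\<^sup>+y. ennreal (dist x y powr (- s)) * indicator {y. 0 < dist x y \<and> dist x y < 1} y \<partial>lborel) < \<infinity>"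
\<comment> \<open>Distance strictly below 1 means exponent at most -1, hence the shift by one. The
  centre lies in no shell, which is why the set asks for positive distance.\<close>
proof (rule nn_integral_powr_shells_finite[where i = "\<lambda>j. - int j - 1"])
  have "2 powr (- (real DIM('a) - s)) < 1" using s by (intro powr_less_one) auto
  then have "summable (\<lambda>j. 2 powr (- (DIM('a) - s)) * (2 powr (- (DIM('a) - s))) ^ j)"
    by (intro summable_mult summable_geometric) simp
  then show "summable (\<lambda>j. 2 powr ((real DIM('a) - s) * real_of_int (- int j - 1)))"
    by (simp add: powr_power powr_add[symmetric] algebra_simps)
next
  fix y assume y: "y \<in> {y. 0 < dist x y \<and> dist x y < 1}"
  then have "\<lfloor>log 2 (dist x y)\<rfloor> < 0" by (simp add: floor_less_iff)
  then have "- int (nat (- \<lfloor>log 2 (dist x y)\<rfloor> - 1)) - 1 = \<lfloor>log 2 (dist x y)\<rfloor>" by simp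
  then show "\<exists>j. 2 powr real_of_int (- int j - 1) \<le> dist x y \<and> dist x y < 2 powr (real_of_int (- int j - 1) + 1)"
    using two_powr_shell[of "dist x y"] y by (intro exI[of _ "nat (- \<lfloor>log 2 (dist x y)\<rfloor> - 1)"]) auto
qed (use s in auto)

lemma nn_integral_powr_far_finite:
  fixes x :: "'a::euclidean_space" and s :: real
  assumes s: "DIM('a) < s"
  shows "(\<integral>\<^sup>+y. ennreal (dist x y powr (- s)) * indicator {y. 1 \<le> dist x y} y \<partial>lborel) < \<infinity>"
proof (rule nn_integral_powr_shells_finite[where i = "\<lambda>j. int j"])
  have "2 powr (real DIM('a) - s) < 1" using s by (simp add: powr_less_one)
  then have "summable (\<lambda>j. (2 powr (DIM('a) - s)) ^ j)"
    by (intro summable_geometric) simp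
  then show "summable (\<lambda>j. 2 powr ((DIM('a) - s) * int j))"
    by (simp add: powr_power algebra_simps)
next
  fix y assume y: "y \<in> {y. 1 \<le> dist x y}"
  then have pos: "0 < dist x y" by auto
  moreover have "0 \<le> log 2 (dist x y)" using y pos by (subst zero_le_log_cancel_iff) auto
  ultimately have "int (nat \<lfloor>log 2 (dist x y)\<rfloor>) = \<lfloor>log 2 (dist x y)\<rfloor>" by simp
  then show "\<exists>j. 2 powr real_of_int (int j) \<le> dist x y \<and> dist x y < 2 powr (real_of_int (int j) + 1)"
    using two_powr_shell[OF pos] by (intro exI[of _ "nat \<lfloor>log 2 (dist x y)\<rfloor>"]) auto
qed (use s in auto)

section \<open>Gradients and weighted norms\<close>

lemma C1_on_GDERIV_gradient:
  "C1_on S f \<Longrightarrow> x \<in> S \<Longrightarrow> GDERIV f x :> gradient f x"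
  unfolding C1_on_def by (auto simp: gradient_eqI)

lemma C1_on_continuous_gradient:
  assumes "C1_on S f" shows "continuous_on S (gradient f)"
proof -
  obtain D where "\<forall>x\<in>S. GDERIV f x :> D x" "continuous_on S D"
    using assms unfolding C1_on_def by blast
  then show ?thesis by (subst continuous_on_cong[of S S "gradient f" D]) (auto simp: gradient_eqI)
qed

lemma C1_on_continuous: "C1_on S f \<Longrightarrow> continuous_on S f"
  unfolding C1_on_def gderiv_def
  by (auto intro!: continuous_at_imp_continuous_on dest!: has_derivative_continuous bspec)

lemma GDERIV_linear_combination:
  assumes "GDERIV u x :> D" "GDERIV v x :> E"
  shows "GDERIV (\<lambda>x. a * u x + b * v x) x :> a *\<^sub>R D + b *\<^sub>R E"
  using has_derivative_add[OF has_derivative_mult_right[of u _ _ a] has_derivative_mult_right[of v _ _ b]] assms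
  unfolding gderiv_def by (simp add: inner_add_right)

text \<open>Serves both for convex combinations along a segment and, with coefficients 1 and -1, for
  differences.\<close>

lemma
  assumes "C1_on UNIV u" "C1_on UNIV v"
  shows C1_on_linear_combination: "C1_on UNIV (\<lambda>x. a * u x + b * v x)"
    and gradient_linear_combination:
      "gradient (\<lambda>x. a * u x + b * v x) x = a *\<^sub>R gradient u x + b *\<^sub>R gradient v x"
proof -
  have D: "GDERIV (\<lambda>x. a * u x + b * v x) x :> a *\<^sub>R gradient u x + b *\<^sub>R gradient v x" for x
    by (rule GDERIV_linear_combination[OF C1_on_GDERIV_gradient[OF assms(1) UNIV_I]
          C1_on_GDERIV_gradient[OF assms(2) UNIV_I]])
  then show "gradient (\<lambda>x. a * u x + b * v x) x = a *\<^sub>R gradient u x + b *\<^sub>R gradient v x"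
    by (rule gradient_eqI)
  show "C1_on UNIV (\<lambda>x. a * u x + b * v x)"
    unfolding C1_on_def
    by (rule exI[of _ "\<lambda>x. a *\<^sub>R gradient u x + b *\<^sub>R gradient v x"])
      (use D assms in \<open>auto intro!: continuous_intros C1_on_continuous_gradient\<close>)
qed

text \<open>The adjoint of an orthogonal map is its inverse, which turns the chain rule into a
  formula for the gradient. The factor \<open>s\<close> is 1 or -1 in the symmetric and
  antisymmetric cases.\<close>

lemma GDERIV_orthogonal:
  fixes T :: "'a::euclidean_space \<Rightarrow> 'a"
  assumes T: "orthogonal_transformation T" and u: "GDERIV u (T x) :> D"
  shows "GDERIV (\<lambda>x. s * u (T x)) x :> s *\<^sub>R inv T D"
proof -
  have lin: "bounded_linear T"
    using T by (simp add: orthogonal_transformation_linear linear_linear)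
  have "T h \<bullet> D = h \<bullet> inv T D" for h
  proof -
    have "T (inv T D) = D" using T by (simp add: orthogonal_transformation_surj surj_f_inv_f)
    moreover have "T h \<bullet> T (inv T D) = h \<bullet> inv T D"
      using T unfolding orthogonal_transformation_def by blast
    ultimately show ?thesis by simp
  qed
  moreover have "((\<lambda>x. u (T x)) has_derivative (\<lambda>h. T h \<bullet> D)) (at x)"
    using has_derivative_compose[OF bounded_linear_imp_has_derivative[OF lin] u[unfolded gderiv_def]] .
  ultimately have "((\<lambda>x. u (T x)) has_derivative (\<lambda>h. h \<bullet> inv T D)) (at x)" by simp
  from has_derivative_mult_right[OF this, of s] show ?thesis
    unfolding gderiv_def by (simp add: mult.commute)
qed

lemma
  fixes u :: "'a::euclidean_space \<Rightarrow> real" and T :: "'a \<Rightarrow> 'a"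
  assumes T: "orthogonal_transformation T" and u: "C1_on UNIV u"
  shows C1_on_orthogonal: "C1_on UNIV (\<lambda>x. s * u (T x))"
    and gradient_orthogonal: "gradient (\<lambda>x. s * u (T x)) x = s *\<^sub>R inv T (gradient u (T x))"
proof -
  have D: "GDERIV (\<lambda>x. s * u (T x)) x :> s *\<^sub>R inv T (gradient u (T x))" for x
    by (rule GDERIV_orthogonal[OF T C1_on_GDERIV_gradient[OF u UNIV_I]])
  then show "gradient (\<lambda>x. s * u (T x)) x = s *\<^sub>R inv T (gradient u (T x))"
    by (rule gradient_eqI)
  have T_cont: "continuous_on UNIV T" and inv_cont: "continuous_on UNIV (inv T)"
    using T orthogonal_transformation_inv[OF T]
    by (simp_all add: linear_continuous_on orthogonal_transformation_linear linear_linear)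
  have "continuous_on UNIV (\<lambda>x. gradient u (T x))"
    by (rule continuous_on_compose2[OF C1_on_continuous_gradient[OF u] T_cont subset_UNIV])
  then have "continuous_on UNIV (\<lambda>x. inv T (gradient u (T x)))"
    by (rule continuous_on_compose2[OF inv_cont _ subset_UNIV])
  then have "continuous_on UNIV (\<lambda>x. s *\<^sub>R inv T (gradient u (T x)))"
    by (rule continuous_on_scaleR[OF continuous_on_const])
  with D show "C1_on UNIV (\<lambda>x. s * u (T x))"
    unfolding C1_on_def by (intro exI[of _ "\<lambda>x. s *\<^sub>R inv T (gradient u (T x))"]) simp
qed

text \<open>A real bound rules out the default value infinity, so it carries the regularity of the
  function with it. The same holds for measurability in the two lemmas on \<open>E_norm_on\<close>
  and \<open>E_norm\<close>.\<close>

lemma F_norm_le_iff: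
  assumes "0 \<le> r"
  shows "F_norm k u \<le> ennreal r \<longleftrightarrow> C1_on UNIV u \<and>
    (\<forall>x. (1 + norm x) powr k * (norm (u x) + norm (gradient u x)) \<le> r)"
  using assms by (auto simp: F_norm_def SUP_le_iff ennreal_le_iff top_unique)

lemma E_norm_on_le_iff:
  assumes "S \<in> sets lebesgue" "0 \<le> r"
  shows "E_norm_on S k u \<le> ennreal r \<longleftrightarrow> u \<in> borel_measurable (lebesgue_on S) \<and>
    (AE x in lebesgue. x \<in> S \<longrightarrow> (1 + norm x) powr k * norm (u x) \<le> r)"
proof (cases "u \<in> borel_measurable (lebesgue_on S)")
  case True
  let ?h = "\<lambda>x. ennreal ((1 + norm x) powr k * norm (u x))"
  have [measurable]: "(\<lambda>x. x) \<in> borel_measurable (lebesgue_on S)"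
    by (intro measurable_restrict_space1 measurable_completion) simp
  have "?h \<in> borel_measurable (lebesgue_on S)"
    using True by measurable
  then have "esssup (lebesgue_on S) ?h \<le> ennreal r \<longleftrightarrow> (AE x in lebesgue_on S. ?h x \<le> ennreal r)"
    using esssup_AE[of ?h "lebesgue_on S"] by (auto intro: esssup_I elim: eventually_mono)
  also have "\<dots> \<longleftrightarrow> (AE x in lebesgue. x \<in> S \<longrightarrow> (1 + norm x) powr k * norm (u x) \<le> r)"
    using assms by (simp add: AE_restrict_space_iff)
  finally show ?thesis using True by (simp add: E_norm_on_def)
qed (simp add: E_norm_on_def top_unique)

lemma E_norm_le_iff:
  assumes "0 \<le> r"
  shows "E_norm k u \<le> ennreal r \<longleftrightarrow> u \<in> borel_measurable lebesgue \<and>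
    (AE x in lebesgue. (1 + norm x) powr k * norm (u x) \<le> r)"
  using assms by (simp add: E_norm_def E_norm_on_le_iff lebesgue_on_UNIV_eq)

section \<open>The Newton potential\<close>

text \<open>Near x the function f is bounded and the exponent n - 2 is below the dimension; far from
  x the decay of f raises the exponent to n + k, above the dimension. The bound on the potential in
  \<open>F_norm\<close> cannot supply this, since a non-integrable integrand also has an integral,
  namely 0.\<close>

lemma integrable_newton_kernel:
  fixes x :: "real^'n" and f :: "real^'n \<Rightarrow> real"
  assumes n: "CARD('n) \<ge> 3" and k: "0 < k" and f: "f \<in> E_space (k + 2)"
  shows "integrable lebesgue (\<lambda>y. norm (x - y) powr (2 - real CARD('n)) * f y)"
proof -
  let ?n = "real CARD('n)"
  obtain r where r: "0 \<le> r" "E_norm (k + 2) f = ennreal r"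
    using f by (cases "E_norm (k + 2) f") (auto simp: E_space_def)
  then have meas [measurable]: "f \<in> borel_measurable lebesgue"
    and bound: "AE y in lebesgue. (1 + norm y) powr (k + 2) * norm (f y) \<le> r"
    using E_norm_le_iff[of r "k + 2" f] by auto
  define N where "N = {y. 0 < dist x y \<and> dist x y < 1}"
  define F where "F = {y. 1 \<le> dist x y}"
  \<comment> \<open>The constant comes from |x - y| \<le> (1 + |x|) (1 + |y|), which trades decay in
    y for decay in x - y. As \<open>c\<close> is at least 1, it also serves near x.\<close>
  define c where "c = (1 + norm x) powr (k + 2)"
  define \<phi> where "\<phi> y = ennreal (dist x y powr (- (?n - 2))) * indicator N y
    + ennreal (dist x y powr (- (?n + k))) * indicator F y" for y
  have [measurable]: "N \<in> sets borel" "F \<in> sets borel" unfolding N_def F_def by measurable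
  have pt: "ennreal (norm (norm (x - y) powr (2 - ?n) * f y)) \<le> ennreal (r * c) * \<phi> y"
    if y: "(1 + norm y) powr (k + 2) * norm (f y) \<le> r" for y
  proof -
    have posy: "0 < (1 + norm y) powr (k + 2)" using norm_ge_zero[of y] by (simp del: norm_ge_zero)
    then have fr: "norm (f y) \<le> r * (1 + norm y) powr (- (k + 2))"
      using y by (simp add: powr_minus_divide pos_le_divide_eq mult.commute del: minus_add_distrib)
    \<comment> \<open>At y = x the kernel is \<open>0 powr _\<close>, which is 0, so the point
      omitted by both regions is harmless.\<close>
    consider "y = x" | "y \<in> N" "y \<notin> F" | "y \<in> F" "y \<notin> N" by (force simp: N_def F_def)
    then show ?thesis
    proof cases
      case 2
      have "(1 + norm y) powr (- (k + 2)) \<le> 1" "1 \<le> c"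
        using k powr_mono[of "- (k + 2)" 0 "1 + norm y"]
        by (auto simp: c_def intro: ge_one_powr_ge_zero split: if_splits)
      then have "norm (f y) \<le> r * c"
        using fr r by (meson mult_left_mono order_trans)
      then have "norm (norm (x - y) powr (2 - ?n) * f y) \<le> (r * c) * dist x y powr (- (?n - 2))"
        by (simp add: abs_mult dist_norm mult.commute mult_right_mono)
      then show ?thesis using 2 r by (simp add: \<phi>_def ennreal_mult'[symmetric] c_def ennreal_leI)
    next
      case 3
      then have d: "1 \<le> dist x y" by (simp add: F_def)
      have "dist x y \<le> (1 + norm x) * (1 + norm y)"
        using norm_triangle_ineq4[of x y] mult_nonneg_nonneg[OF norm_ge_zero[of x] norm_ge_zero[of y]]
        unfolding dist_norm distrib_left distrib_right mult_1 mult_1_right by linarith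
      then have "dist x y powr (k + 2) \<le> c * (1 + norm y) powr (k + 2)"
        unfolding c_def powr_mult[symmetric] using k d by (intro powr_mono2) auto
      then have "(1 + norm y) powr (- (k + 2)) \<le> c * dist x y powr (- (k + 2))"
        using d posy by (cases "x = y") (auto simp add: powr_minus_divide field_simps simp del: minus_add_distrib)
      then have "norm (f y) \<le> r * (c * dist x y powr (- (k + 2)))"
        using fr r by (meson mult_left_mono order_trans)
      then have "norm (norm (x - y) powr (2 - ?n) * f y)
          \<le> dist x y powr (2 - ?n) * (r * (c * dist x y powr (- (k + 2))))"
        by (simp add: abs_mult dist_norm mult_left_mono)
      also have "\<dots> = (r * c) * dist x y powr (- (?n + k))"
        using d by (simp add: powr_add[symmetric])
      finally show ?thesis using 3 r by (simp add: \<phi>_def ennreal_mult'[symmetric] c_def ennreal_leI)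
    qed simp
  qed
  have "(\<integral>\<^sup>+y. ennreal (norm (norm (x - y) powr (2 - ?n) * f y)) \<partial>lebesgue)
      \<le> (\<integral>\<^sup>+y. ennreal (r * c) * \<phi> y \<partial>lebesgue)"
    by (intro nn_integral_mono_AE eventually_mono[OF bound] pt)
  also have "\<dots> = (\<integral>\<^sup>+y. ennreal (r * c) * \<phi> y \<partial>lborel)"
    unfolding \<phi>_def by (intro nn_integral_completion)
  also have "\<dots> = ennreal (r * c) * ((\<integral>\<^sup>+y. ennreal (dist x y powr (- (?n - 2))) * indicator N y \<partial>lborel)
      + (\<integral>\<^sup>+y. ennreal (dist x y powr (- (?n + k))) * indicator F y \<partial>lborel))"
    unfolding \<phi>_def by (simp add: nn_integral_cmult nn_integral_add)
  also have "\<dots> < \<infinity>"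
    using nn_integral_powr_near_finite[of "?n - 2" x] nn_integral_powr_far_finite[of "?n + k" x] n k
    by (auto simp: N_def F_def ennreal_mult_less_top)
  finally have fin: "(\<integral>\<^sup>+y. ennreal (norm (norm (x - y) powr (2 - ?n) * f y)) \<partial>lebesgue) < \<infinity>" .
  have "(\<lambda>y. norm (x - y) powr (2 - ?n)) \<in> borel_measurable lebesgue"
    by (intro measurable_completion) simp
  then have "(\<lambda>y. norm (x - y) powr (2 - ?n) * f y) \<in> borel_measurable lebesgue"
    by measurable
  then show ?thesis using fin by (rule integrableI_bounded)
qed

lemma newton_potential_diff:
  fixes f h :: "real^'n \<Rightarrow> real"
  assumes n: "CARD('n) \<ge> 3" and k: "0 < k"
    and "f \<in> E_space (k + 2)" "h \<in> E_space (k + 2)"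
  shows "newton_potential (\<lambda>y. f y - h y) x = newton_potential f x - newton_potential h x"
  using integrable_newton_kernel[OF n k assms(3), of x] integrable_newton_kernel[OF n k assms(4), of x]
  unfolding newton_potential_def by (simp add: right_diff_distrib Bochner_Integration.integral_diff)

lemma newton_potential_orthogonal:
  fixes f :: "real^'n \<Rightarrow> real" and T :: "real^'n \<Rightarrow> real^'n"
  assumes T: "orthogonal_transformation T" and f: "f \<in> borel_measurable lebesgue"
  shows "newton_potential (\<lambda>y. s * f (T y)) x = s * newton_potential f (T x)"
proof -
  let ?h = "\<lambda>y. norm (T x - y) powr (2 - real CARD('n)) * f y"
  have "(\<lambda>y. norm (T x - y) powr (2 - real CARD('n))) \<in> borel_measurable lebesgue"
    by (intro measurable_completion) simp
  then have meas: "?h \<in> borel_measurable lebesgue" using f by measurable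
  have iso: "norm (x - y) = norm (T x - T y)" for y
    using T by (metis orthogonal_transformation_def linear_diff orthogonal_transformation_norm)
  have "(LINT y|lebesgue. norm (x - y) powr (2 - real CARD('n)) * (s * f (T y)))
      = s * (LINT y|lebesgue. ?h (T y))"
    unfolding iso by (simp add: mult.left_commute flip: integral_mult_right_zero)
  also have "(LINT y|lebesgue. ?h (T y)) = (LINT y|distr lebesgue lebesgue T. ?h y)"
    using lebesgue_measurable_orthogonal[OF T] meas by (rule integral_distr[symmetric])
  also have "\<dots> = (LINT y|lebesgue. ?h y)" by (simp add: distr_lebesgue_orthogonal[OF T])
  finally show ?thesis unfolding newton_potential_def by simp
qed

text \<open>The kernel vanishes only at y = x, so it can be divided out off a null set. This
  recovers measurability of the source from integrability of its product with the kernel.\<close>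

lemma borel_measurable_if_newton_kernel_measurable:
  fixes f :: "real^'n \<Rightarrow> real"
  assumes "(\<lambda>y. norm (x - y) powr a * f y) \<in> borel_measurable lebesgue"
  shows "f \<in> borel_measurable lebesgue"
proof -
  have "(\<lambda>y. norm (x - y) powr (- a)) \<in> borel_measurable lebesgue"
    by (intro measurable_completion) simp
  then have "(\<lambda>y. norm (x - y) powr (- a) * (norm (x - y) powr a * f y)) \<in> borel_measurable lebesgue"
    using assms by measurable
  moreover have "AE y in lebesgue. norm (x - y) powr (- a) * (norm (x - y) powr a * f y) = f y"
  proof (rule AE_I')
    show "{x} \<in> null_sets lebesgue" by simp
  qed (auto simp: mult.assoc[symmetric] powr_add[symmetric])
  ultimately show ?thesis
    by (rule borel_measurable_AE)
qed

section \<open>Lipschitz estimate for the nonlinearity\<close>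

text \<open>Integrate the derivative of f along the segment. The fundamental theorem of calculus
  tolerates finitely many exceptional points for a continuous function, and a nondegenerate segment
  meets the origin at most once.\<close>

lemma lipschitz_along_segment:
  fixes f :: "'a::euclidean_space \<Rightarrow> real" and a b :: 'a
  defines "\<gamma> \<equiv> \<lambda>t. a + t *\<^sub>R (b - a)"
  assumes C1: "C1_on (UNIV - {0}) f" and cont: "continuous_on UNIV f" and m: "0 \<le> m"
    and bound: "\<And>t. t \<in> \<rat> \<Longrightarrow> 0 < t \<Longrightarrow> t < 1 \<Longrightarrow> \<gamma> t \<noteq> 0 \<Longrightarrow> norm (gradient f (\<gamma> t)) \<le> m"
  shows "\<bar>f b - f a\<bar> \<le> m * norm (b - a)"
proof (cases "a = b")
  case False
  have cont\<gamma>: "continuous_on S \<gamma>" for S unfolding \<gamma>_def by (intro continuous_intros)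
  \<comment> \<open>A strict violation of the bound is an open condition on the parameter, so it
    would persist at a nearby rational.\<close>
  have bound': "norm (gradient f (\<gamma> t)) \<le> m" if t: "0 < t" "t < 1" "\<gamma> t \<noteq> 0" for t
  proof (rule ccontr)
    assume gt: "\<not> norm (gradient f (\<gamma> t)) \<le> m"
    define U where "U = {0<..<1} \<inter> \<gamma> -` (- {0})"
    have U: "open U"
      unfolding U_def by (intro continuous_open_preimage cont\<gamma>) auto
    have "continuous_on U (\<lambda>t. norm (gradient f (\<gamma> t)))"
      by (intro continuous_on_norm continuous_on_compose2[OF C1_on_continuous_gradient[OF C1] cont\<gamma>])
        (auto simp: U_def)
    then have V: "open (U \<inter> (\<lambda>t. norm (gradient f (\<gamma> t))) -` {m<..})" (is "open ?V")
      using U by (rule continuous_open_preimage) simp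
    have "t \<in> ?V" using t gt by (auto simp: U_def)
    then obtain e where e: "0 < e" "ball t e \<subseteq> ?V" using V open_contains_ball by blast
    obtain q where q: "q \<in> \<rat>" "t < q" "q < t + e"
      using Rats_dense_in_real[of t "t + e"] e by auto
    then have "q \<in> ball t e" by (simp add: dist_real_def)
    then have "q \<in> ?V" using e(2) by blast
    then show False using bound[OF q(1)] by (auto simp: U_def)
  qed
  \<comment> \<open>The value 0 at the exceptional parameters leaves the integral unchanged and
    satisfies the norm bound trivially.\<close>
  define F' where "F' t = (if t \<in> {0<..<1} \<and> \<gamma> t \<noteq> 0 then (b - a) \<bullet> gradient f (\<gamma> t) else 0)" for t
  have "finite {t. \<gamma> t = 0}"
  proof -
    have "{t. \<gamma> t = 0} \<subseteq> {s}" if "\<gamma> s = 0" for s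
    proof clarsimp
      fix t assume "\<gamma> t = 0"
      have "(s - t) *\<^sub>R (b - a) = \<gamma> s - \<gamma> t" by (simp add: \<gamma>_def scaleR_left_diff_distrib)
      then show "t = s" using that \<open>\<gamma> t = 0\<close> False by simp
    qed
    then show ?thesis by (cases "\<exists>s. \<gamma> s = 0") (auto intro: finite_subset)
  qed
  moreover have "((\<lambda>t. f (\<gamma> t)) has_vector_derivative F' t) (at t)"
    if "t \<in> {0<..<1} - {t. \<gamma> t = 0}" for t
  proof -
    have "(\<gamma> has_derivative (\<lambda>h. h *\<^sub>R (b - a))) (at t)"
      unfolding \<gamma>_def by (auto intro!: derivative_eq_intros)
    moreover have "GDERIV f (\<gamma> t) :> gradient f (\<gamma> t)"
      using that by (intro C1_on_GDERIV_gradient[OF C1]) auto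
    ultimately have "((\<lambda>t. f (\<gamma> t)) has_derivative (\<lambda>h. (h *\<^sub>R (b - a)) \<bullet> gradient f (\<gamma> t))) (at t)"
      unfolding gderiv_def by (rule has_derivative_compose)
    then show ?thesis using that by (simp add: has_vector_derivative_def F'_def)
  qed
  moreover have "continuous_on {0..1} (\<lambda>t. f (\<gamma> t))"
    by (intro continuous_on_compose2[OF cont cont\<gamma>]) auto
  ultimately have "(F' has_integral (f (\<gamma> 1) - f (\<gamma> 0))) {0..1}"
    by (intro fundamental_theorem_of_calculus_interior_strong) auto
  moreover have "norm (F' t) \<le> m * norm (b - a)" for t
  proof (cases "t \<in> {0<..<1} \<and> \<gamma> t \<noteq> 0")
    case True
    then have "norm (b - a) * norm (gradient f (\<gamma> t)) \<le> norm (b - a) * m"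
      by (intro mult_left_mono bound') auto
    then show ?thesis
      using True Cauchy_Schwarz_ineq2[of "b - a" "gradient f (\<gamma> t)"]
      by (simp add: F'_def mult.commute)
  qed (use m in \<open>auto simp: F'_def\<close>)
  ultimately have "norm (f (\<gamma> 1) - f (\<gamma> 0)) \<le> m * norm (b - a) * measure lborel {0..1::real}"
    using m by (intro has_integral_bound_real) auto
  then show ?thesis by (simp add: \<gamma>_def)
qed simp

text \<open>Keeps the segment between two functions of the ball inside the ball over which
  \<open>grad_zp_sup\<close> is taken.\<close>

lemma F_norm_convex_combination_le:
  assumes "F_norm k u \<le> ennreal r" "F_norm k v \<le> ennreal r" "0 \<le> r" "0 \<le> t" "t \<le> 1"
  shows "F_norm k (\<lambda>x. (1 - t) * u x + t * v x) \<le> ennreal r"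
proof -
  have u: "C1_on UNIV u" "\<And>x. (1 + norm x) powr k * (norm (u x) + norm (gradient u x)) \<le> r"
    and v: "C1_on UNIV v" "\<And>x. (1 + norm x) powr k * (norm (v x) + norm (gradient v x)) \<le> r"
    using assms by (auto simp: F_norm_le_iff)
  have "(1 + norm x) powr k * (norm ((1 - t) * u x + t * v x)
      + norm ((1 - t) *\<^sub>R gradient u x + t *\<^sub>R gradient v x)) \<le> r" for x
  proof -
    have "norm ((1 - t) * u x + t * v x) \<le> (1 - t) * norm (u x) + t * norm (v x)"
      using norm_triangle_ineq[of "(1 - t) * u x" "t * v x"] assms by (simp add: abs_mult)
    moreover have "norm ((1 - t) *\<^sub>R gradient u x + t *\<^sub>R gradient v x)
        \<le> (1 - t) * norm (gradient u x) + t * norm (gradient v x)"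
      using norm_triangle_ineq[of "(1 - t) *\<^sub>R gradient u x" "t *\<^sub>R gradient v x"] assms by simp
    ultimately have "norm ((1 - t) * u x + t * v x) + norm ((1 - t) *\<^sub>R gradient u x + t *\<^sub>R gradient v x)
        \<le> (1 - t) * (norm (u x) + norm (gradient u x)) + t * (norm (v x) + norm (gradient v x))"
      by (simp add: algebra_simps)
    from mult_left_mono[OF this powr_ge_zero[of "1 + norm x" k]]
    have "(1 + norm x) powr k * (norm ((1 - t) * u x + t * v x)
        + norm ((1 - t) *\<^sub>R gradient u x + t *\<^sub>R gradient v x))
        \<le> (1 - t) * ((1 + norm x) powr k * (norm (u x) + norm (gradient u x)))
          + t * ((1 + norm x) powr k * (norm (v x) + norm (gradient v x)))"
      by (simp only: distrib_left mult.left_commute)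
    also have "\<dots> \<le> (1 - t) * r + t * r"
      using assms by (intro add_mono mult_left_mono u v) auto
    finally show ?thesis by (simp add: algebra_simps)
  qed
  then show ?thesis
    using u(1) v(1) assms(3)
    by (simp add: F_norm_le_iff C1_on_linear_combination gradient_linear_combination)
qed

text \<open>The supremum leaves out w = 0, but then the premise under the quantifier never holds.
  The exceptional null set depends on w.\<close>

lemma AE_grad_zp_le:
  assumes sup: "grad_zp_sup k g \<epsilon> \<le> ennreal m" and m: "0 \<le> m"
    and w: "F_norm k w \<le> ennreal \<epsilon>"
  shows "AE x in lebesgue. (w x, gradient w x) \<noteq> (0, 0) \<longrightarrow>
    (1 + norm x) powr 2 * norm (grad_zp g x (w x) (gradient w x)) \<le> m"
proof (cases "F_norm k w = 0")
  case True
  then have "(1 + norm x) powr k * (norm (w x) + norm (gradient w x)) \<le> 0" for x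
    using F_norm_le_iff[of 0 k w] by simp
  moreover have "0 < (1 + norm x) powr k" for x :: "real^'a"
    using norm_ge_zero[of x] by (simp del: norm_ge_zero)
  ultimately have le: "norm (w x) + norm (gradient w x) \<le> 0" for x
    by (meson mult_le_0_iff not_le)
  have "(w x, gradient w x) = (0, 0)" for x
  proof -
    have "norm (w x) = 0" "norm (gradient w x) = 0"
      using le[of x] norm_ge_zero[of "w x"] norm_ge_zero[of "gradient w x"] by linarith+
    then show ?thesis by simp
  qed
  then show ?thesis by simp
next
  case False
  have fin: "F_norm k w < \<infinity>" using w by (simp add: le_less_trans[OF _ ennreal_less_top])
  then have C1: "C1_on UNIV w" by (auto simp: F_norm_def split: if_splits)
  let ?S = "{x. (w x, gradient w x) \<noteq> (0, 0)}"
  have "open ((\<lambda>x. (w x, gradient w x)) -` (- {(0, 0)}))"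
    using C1_on_continuous[OF C1] C1_on_continuous_gradient[OF C1]
    by (intro open_vimage continuous_on_Pair) auto
  then have "?S \<in> sets lebesgue" by (auto simp: vimage_def intro: lborelD)
  moreover have "E_norm_on ?S 2 (\<lambda>x. grad_zp g x (w x) (gradient w x)) \<le> ennreal m"
    using fin False w
    by (intro order_trans[OF SUP_upper sup[unfolded grad_zp_sup_def]])
      (auto simp: F_space_def zero_less_iff_neq_zero)
  ultimately show ?thesis using m by (simp only: E_norm_on_le_iff mem_Collect_eq)
qed

text \<open>At a fixed x, the segment in (z, p)-space from (v, Dv) to (u, Du) consists of the values
  and gradients at x of the functions \<open>w t\<close>, all in the ball. Hence g(x, ., .) has
  Lipschitz constant \<open>m\<close> / (1 + |x|)^2 along it.\<close>

lemma AE_source_difference_le: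
  fixes g :: "real^'n \<Rightarrow> real \<Rightarrow> real^'n \<Rightarrow> real"
  assumes C1: "\<And>x. C1_on (UNIV - {(0, 0)}) (\<lambda>(z, p). g x z p)"
    and cont: "\<And>x. continuous_on UNIV (\<lambda>(z, p). g x z p)"
    and sup: "grad_zp_sup k g \<epsilon> \<le> ennreal m" and m: "0 \<le> m" and \<epsilon>: "0 \<le> \<epsilon>"
    and u: "F_norm k u \<le> ennreal \<epsilon>" and v: "F_norm k v \<le> ennreal \<epsilon>"
  shows "AE x in lebesgue. (1 + norm x) powr 2 * \<bar>g x (u x) (gradient u x) - g x (v x) (gradient v x)\<bar>
    \<le> m * (norm (u x - v x) + norm (gradient u x - gradient v x))"
proof -
  define w where "w t x = (1 - t) * v x + t * u x" for t x
  have C1': "C1_on UNIV u" "C1_on UNIV v" using u v \<epsilon> by (auto simp: F_norm_le_iff)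
  have grad_w: "gradient (w t) x = (1 - t) *\<^sub>R gradient v x + t *\<^sub>R gradient u x" for t x
    unfolding w_def using C1' by (simp add: gradient_linear_combination)
  text \<open>Only rational \<open>t\<close>, so that a single null set serves for all of them.\<close>
  have "AE x in lebesgue. \<forall>t\<in>\<rat> \<inter> {0<..<1}. (w t x, gradient (w t) x) \<noteq> (0, 0) \<longrightarrow>
      (1 + norm x) powr 2 * norm (grad_zp g x (w t x) (gradient (w t) x)) \<le> m"
  proof (intro AE_ball_countable' AE_grad_zp_le[OF sup m])
    show "countable (\<rat> \<inter> {0<..<1::real})" using countable_rat by blast
    fix t :: real assume "t \<in> \<rat> \<inter> {0<..<1}"
    then show "F_norm k (w t) \<le> ennreal \<epsilon>"
      unfolding w_def using u v \<epsilon> by (intro F_norm_convex_combination_le) auto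
  qed
  then show ?thesis
  proof (rule eventually_mono)
    fix x
    assume rat: "\<forall>t\<in>\<rat> \<inter> {0<..<1}. (w t x, gradient (w t) x) \<noteq> (0, 0) \<longrightarrow>
      (1 + norm x) powr 2 * norm (grad_zp g x (w t x) (gradient (w t) x)) \<le> m"
    let ?a = "(v x, gradient v x)" and ?b = "(u x, gradient u x)"
    let ?c = "(1 + norm x) powr 2"
    have c: "0 < ?c" using norm_ge_zero[of x] by (simp del: norm_ge_zero)
    have seg: "?a + t *\<^sub>R (?b - ?a) = (w t x, gradient (w t) x)" for t
      unfolding grad_w by (simp add: w_def algebra_simps)
    have "\<bar>(\<lambda>(z, p). g x z p) ?b - (\<lambda>(z, p). g x z p) ?a\<bar> \<le> m / ?c * norm (?b - ?a)"
    proof (rule lipschitz_along_segment)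
      show "C1_on (UNIV - {0}) (\<lambda>(z, p). g x z p)" using C1 by (simp add: zero_prod_def)
      fix t :: real
      assume "t \<in> \<rat>" "0 < t" "t < 1" and nz: "?a + t *\<^sub>R (?b - ?a) \<noteq> 0"
      moreover have "(w t x, gradient (w t) x) \<noteq> (0, 0)" using nz unfolding seg by (simp add: zero_prod_def)
      ultimately have "?c * norm (grad_zp g x (w t x) (gradient (w t) x)) \<le> m" using rat by simp
      then show "norm (gradient (\<lambda>(z, p). g x z p) (?a + t *\<^sub>R (?b - ?a))) \<le> m / ?c"
        unfolding seg using c by (simp add: grad_zp_def pos_le_divide_eq mult.commute)
    qed (use cont m in auto)
    then have "?c * \<bar>g x (u x) (gradient u x) - g x (v x) (gradient v x)\<bar> \<le> m * norm (?b - ?a)"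
      using c by (simp add: field_simps)
    \<comment> \<open>Passes from the Euclidean norm of the pair to the sum of norms that occurs in
      \<open>F_norm\<close>.\<close>
    also have "\<dots> \<le> m * (norm (u x - v x) + norm (gradient u x - gradient v x))"
      using m norm_Pair_le[of "u x - v x" "gradient u x - gradient v x"]
      by (intro mult_left_mono) auto
    finally show "?c * \<bar>g x (u x) (gradient u x) - g x (v x) (gradient v x)\<bar>
      \<le> m * (norm (u x - v x) + norm (gradient u x - gradient v x))" .
  qed
qed

section \<open>Uniqueness and symmetry of solutions\<close>

text \<open>The real number \<open>m\<close> stands for the gradient supremum, and
  \<open>C * m\<close> is the contraction constant; both are real so that the final estimate is
  ordinary arithmetic rather than arithmetic in \<open>ennreal\<close>.\<close>

locale newton_equation =
  fixes g :: "real^'n \<Rightarrow> real \<Rightarrow> real^'n \<Rightarrow> real" and k C m \<epsilon> :: real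
  assumes n: "CARD('n) \<ge> 3" and k: "0 < k" and C: "0 \<le> C" and m: "0 \<le> m" and \<epsilon>: "0 \<le> \<epsilon>"
    and C_bound: "\<And>f :: real^'n \<Rightarrow> real. f \<in> E_space (k + 2) \<Longrightarrow>
      F_norm k (newton_potential f) \<le> ennreal C * E_norm (k + 2) f"
    and C1: "\<And>x. C1_on (UNIV - {(0, 0)}) (\<lambda>(z, p). g x z p)"
    and cont: "\<And>x. continuous_on UNIV (\<lambda>(z, p). g x z p)"
    and zero: "(\<lambda>x. g x 0 0) \<in> E_space (k + 2)"
    and sup: "grad_zp_sup k g \<epsilon> \<le> ennreal m"
    and contraction: "C * m < 1"
begin

definition source :: "(real^'n \<Rightarrow> real) \<Rightarrow> real^'n \<Rightarrow> real" where
  "source u = (\<lambda>y. g y (u y) (gradient u y))"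

definition solution :: "(real^'n \<Rightarrow> real) \<Rightarrow> bool" where
  "solution u \<longleftrightarrow> F_norm k u \<le> ennreal \<epsilon> \<and> (\<forall>x. u x = newton_potential (source u) x)"

lemma source_zero: "source (\<lambda>_. 0) = (\<lambda>x. g x 0 0)"
  unfolding source_def by (simp add: gradient_eqI[OF GDERIV_const])

text \<open>A nonmeasurable source has potential \<open>0\<close>, since the Bochner integral of a non-integrable
  function is \<open>0\<close>.\<close>

lemma borel_measurable_source:
  assumes "solution u" shows "source u \<in> borel_measurable lebesgue"
proof (cases "u = (\<lambda>_. 0)")
  case True
  obtain r where "0 \<le> r" "E_norm (k + 2) (\<lambda>x. g x 0 0) = ennreal r"
    using zero by (cases "E_norm (k + 2) (\<lambda>x. g x 0 0)") (auto simp: E_space_def)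
  then show ?thesis
    unfolding True source_zero using E_norm_le_iff[of r "k + 2"] by fastforce
next
  case False
  \<comment> \<open>At this x the integral is not the default 0, so its integrand is
    integrable.\<close>
  then obtain x where "u x \<noteq> 0" by auto
  then have "newton_potential (source u) x \<noteq> 0"
    using assms unfolding solution_def by metis
  then have "integrable lebesgue (\<lambda>y. norm (x - y) powr (2 - real CARD('n)) * source u y)"
    unfolding newton_potential_def using not_integrable_integral_eq by fastforce
  then show ?thesis
    by (rule borel_measurable_if_newton_kernel_measurable[OF borel_measurable_integrable])
qed

text \<open>The weight of exponent k + 2 splits: the factor with exponent 2 is absorbed by the
  gradient bound on g, the one with exponent k by the norm of u - v.\<close>

lemma AE_source_diff_le:
  assumes "F_norm k u \<le> ennreal \<epsilon>" "F_norm k v \<le> ennreal \<epsilon>"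
    and r: "F_norm k (\<lambda>x. u x - v x) \<le> ennreal r" "0 \<le> r"
  shows "AE x in lebesgue. (1 + norm x) powr (k + 2) * norm (source u x - source v x) \<le> m * r"
  using AE_source_difference_le[OF C1 cont sup m \<epsilon> assms(1,2)]
proof (rule eventually_mono)
  fix x
  assume le: "(1 + norm x) powr 2 * \<bar>g x (u x) (gradient u x) - g x (v x) (gradient v x)\<bar>
    \<le> m * (norm (u x - v x) + norm (gradient u x - gradient v x))"
  have C1': "C1_on UNIV u" "C1_on UNIV v" using assms(1,2) \<epsilon> by (auto simp: F_norm_le_iff)
  have "gradient (\<lambda>x. u x - v x) x = gradient u x - gradient v x"
    using gradient_linear_combination[OF C1', of 1 "-1" x] by simp
  then have "(1 + norm x) powr k * (norm (u x - v x) + norm (gradient u x - gradient v x)) \<le> r"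
    using r F_norm_le_iff[of r k "\<lambda>x. u x - v x"] by metis
  then have *: "m * ((1 + norm x) powr k * (norm (u x - v x) + norm (gradient u x - gradient v x))) \<le> m * r"
    using m by (rule mult_left_mono)
  have "(1 + norm x) powr (k + 2) * norm (source u x - source v x)
      = (1 + norm x) powr k * ((1 + norm x) powr 2 * \<bar>g x (u x) (gradient u x) - g x (v x) (gradient v x)\<bar>)"
    by (simp only: powr_add source_def mult.assoc real_norm_def)
  also have "\<dots> \<le> (1 + norm x) powr k * (m * (norm (u x - v x) + norm (gradient u x - gradient v x)))"
    using le by (intro mult_left_mono) auto
  also have "\<dots> \<le> m * r" using * by (simp add: mult.left_commute)
  finally show "(1 + norm x) powr (k + 2) * norm (source u x - source v x) \<le> m * r" .
qed

lemma F_norm_zero: "F_norm k (\<lambda>_::real^'n. 0) \<le> ennreal \<epsilon>"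
proof -
  have "C1_on UNIV (\<lambda>_::real^'n. 0)" unfolding C1_on_def using GDERIV_const by fastforce
  then show ?thesis using \<epsilon> by (simp add: F_norm_le_iff gradient_eqI[OF GDERIV_const])
qed

text \<open>Compare with the source of the zero function, which is g(., 0, 0): the difference costs
  at most \<open>m * \<epsilon>\<close>, because u - 0 has norm at most \<epsilon>.\<close>

lemma source_in_E_space:
  assumes u: "solution u" shows "source u \<in> E_space (k + 2)"
proof -
  obtain r where r: "0 \<le> r" "E_norm (k + 2) (\<lambda>x. g x 0 0) = ennreal r"
    using zero by (cases "E_norm (k + 2) (\<lambda>x. g x 0 0)") (auto simp: E_space_def)
  have "AE x in lebesgue. (1 + norm x) powr (k + 2) * norm (g x 0 0) \<le> r"
    using r E_norm_le_iff[of r "k + 2"] by fastforce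
  moreover have "AE x in lebesgue. (1 + norm x) powr (k + 2) * norm (source u x - g x 0 0) \<le> m * \<epsilon>"
    using AE_source_diff_le[of u "\<lambda>_. 0" \<epsilon>] u F_norm_zero \<epsilon> by (simp add: solution_def source_zero)
  ultimately have "AE x in lebesgue. (1 + norm x) powr (k + 2) * norm (source u x) \<le> r + m * \<epsilon>"
  proof eventually_elim
    case (elim x)
    have "norm (source u x) \<le> norm (g x 0 0) + norm (source u x - g x 0 0)" by simp
    then have "(1 + norm x) powr (k + 2) * norm (source u x)
        \<le> (1 + norm x) powr (k + 2) * (norm (g x 0 0) + norm (source u x - g x 0 0))"
      by (intro mult_left_mono) auto
    then show ?case using elim by (simp add: distrib_left)
  qed
  then have "E_norm (k + 2) (source u) \<le> ennreal (r + m * \<epsilon>)"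
    using borel_measurable_source[OF u] r m \<epsilon> by (subst E_norm_le_iff) auto
  then show ?thesis by (simp add: E_space_def le_less_trans[OF _ ennreal_less_top])
qed

lemma solution_unique:
  assumes u: "solution u" and v: "solution v"
  shows "u = v"
proof -
  note Eu = source_in_E_space[OF u] and Ev = source_in_E_space[OF v]
  have bd: "F_norm k u \<le> ennreal \<epsilon>" "F_norm k v \<le> ennreal \<epsilon>"
    using u v by (simp_all add: solution_def)
  have C1': "C1_on UNIV u" "C1_on UNIV v" using bd \<epsilon> by (auto simp: F_norm_le_iff)
  have pot: "newton_potential (\<lambda>y. source u y - source v y) = (\<lambda>x. u x - v x)"
    using newton_potential_diff[OF n k Eu Ev] u v by (auto simp: solution_def)
  have step: "F_norm k (\<lambda>x. u x - v x) \<le> ennreal (C * (m * r))"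
    if r: "F_norm k (\<lambda>x. u x - v x) \<le> ennreal r" "0 \<le> r" for r
  proof -
    have E: "E_norm (k + 2) (\<lambda>y. source u y - source v y) \<le> ennreal (m * r)"
      using AE_source_diff_le[OF bd r] borel_measurable_source[OF u] borel_measurable_source[OF v] m r
      by (subst E_norm_le_iff) auto
    then have "(\<lambda>y. source u y - source v y) \<in> E_space (k + 2)"
      by (simp add: E_space_def le_less_trans[OF _ ennreal_less_top])
    from C_bound[OF this] have "F_norm k (\<lambda>x. u x - v x)
        \<le> ennreal C * E_norm (k + 2) (\<lambda>y. source u y - source v y)" by (simp add: pot)
    also have "\<dots> \<le> ennreal C * ennreal (m * r)" using E by (rule mult_left_mono) simp
    finally show ?thesis using C m r by (simp add: ennreal_mult)
  qed
  \<comment> \<open>Finiteness comes first: \<open>r \<le> C * m * r\<close> forces r = 0 only for a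
    finite r.\<close>
  have "F_norm k (\<lambda>x. u x - v x) \<noteq> \<infinity>"
  proof -
    have "gradient (\<lambda>x. u x - v x) x = gradient u x - gradient v x" for x :: "real^'n"
      using gradient_linear_combination[OF C1', of 1 "-1" x] by simp
    moreover have "C1_on UNIV (\<lambda>x. u x - v x)"
      using C1_on_linear_combination[OF C1', of 1 "-1"] by simp
    moreover have "(1 + norm x) powr k * (norm (u x - v x) + norm (gradient u x - gradient v x))
        \<le> \<epsilon> + \<epsilon>" for x :: "real^'n"
    proof -
      have "norm (u x - v x) + norm (gradient u x - gradient v x)
          \<le> (norm (u x) + norm (gradient u x)) + (norm (v x) + norm (gradient v x))"
        using norm_triangle_ineq4[of "u x" "v x"] norm_triangle_ineq4[of "gradient u x" "gradient v x"]
        by linarith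
      then have "(1 + norm x) powr k * (norm (u x - v x) + norm (gradient u x - gradient v x))
          \<le> (1 + norm x) powr k * ((norm (u x) + norm (gradient u x)) + (norm (v x) + norm (gradient v x)))"
        by (intro mult_left_mono) auto
      also have "\<dots> \<le> \<epsilon> + \<epsilon>"
        using bd \<epsilon> unfolding distrib_left[of _ "norm (u x) + norm (gradient u x)"]
        by (intro add_mono) (auto simp: F_norm_le_iff)
      finally show ?thesis .
    qed
    ultimately have "F_norm k (\<lambda>x. u x - v x) \<le> ennreal (\<epsilon> + \<epsilon>)"
      using \<epsilon> by (subst F_norm_le_iff) auto
    then show ?thesis by (auto simp: top_unique)
  qed
  then obtain r where r: "0 \<le> r" "F_norm k (\<lambda>x. u x - v x) = ennreal r"
    by (cases "F_norm k (\<lambda>x. u x - v x)") auto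
  have "r \<le> C * m * r" using step[of r] r C m by (simp add: ennreal_le_iff mult.assoc)
  then have "(1 - C * m) * r \<le> 0" by (simp add: algebra_simps)
  then have "r = 0" using contraction r(1) by (auto simp: mult_le_0_iff)
  then have le0: "(1 + norm x) powr k * (norm (u x - v x) + norm (gradient (\<lambda>x. u x - v x) x)) \<le> 0" for x :: "real^'n"
    using r F_norm_le_iff[of 0 k "\<lambda>x. u x - v x"] by simp
  show ?thesis
  proof
    fix x :: "real^'n"
    have "0 < (1 + norm x) powr k" using norm_ge_zero[of x] by (simp del: norm_ge_zero)
    then have "norm (u x - v x) + norm (gradient (\<lambda>x. u x - v x) x) \<le> 0"
      using le0[of x] by (simp add: mult_le_0_iff)
    then have "norm (u x - v x) \<le> 0"
      using norm_ge_zero[of "gradient (\<lambda>x. u x - v x) x"] by linarith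
    then show "u x = v x" by simp
  qed
qed

text \<open>The condition on \<open>g\<close>, read at z = u(T x) and p = Du(T x), says that the
  source of the transformed function is \<open>s\<close> times the source of u composed with T. The
  condition on \<open>s\<close> preserves the norm.\<close>

lemma solution_transform:
  assumes u: "solution u" and T: "orthogonal_transformation T" and s: "\<bar>s\<bar> = 1"
    and g: "\<And>x z p. g x (s * z) (s *\<^sub>R inv T p) = s * g (T x) z p"
  shows "u x = s * u (T x)"
proof -
  let ?v = "\<lambda>x. s * u (T x)"
  have bd: "F_norm k u \<le> ennreal \<epsilon>" using u by (simp add: solution_def)
  then have C1': "C1_on UNIV u" using \<epsilon> by (auto simp: F_norm_le_iff)
  note grad = gradient_orthogonal[OF T C1', of s]
  have "source ?v = (\<lambda>y. s * source u (T y))"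
    unfolding source_def grad g ..
  then have "newton_potential (source ?v) x = s * newton_potential (source u) (T x)" for x
    using newton_potential_orthogonal[OF T borel_measurable_source[OF u]] by simp
  moreover have "F_norm k ?v \<le> ennreal \<epsilon>"
  proof -
    have "(1 + norm x) powr k * (norm (?v x) + norm (gradient ?v x)) \<le> \<epsilon>" for x
    proof -
      have "norm (?v x) + norm (gradient ?v x) = norm (u (T x)) + norm (gradient u (T x))"
        using s T by (simp add: grad abs_mult orthogonal_transformation_norm orthogonal_transformation_inv)
      moreover have "norm (T x) = norm x" using T by (rule orthogonal_transformation_norm)
      ultimately show ?thesis using bd \<epsilon> F_norm_le_iff[of \<epsilon> k u] by metis
    qed
    then show ?thesis using \<epsilon> C1_on_orthogonal[OF T C1'] by (simp add: F_norm_le_iff)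
  qed
  ultimately have "solution ?v" using u by (simp add: solution_def)
  from solution_unique[OF u this] show ?thesis by (rule fun_cong)
qed

end

text \<open>In (B) the set \<G> is nonempty, since antisymmetry under the empty set is vacuous. In
  (C) evenness in p accompanies evenness in z: the gradient of the transformed function is -T^{-1}
  Du(T x), and symmetry in p under \<G> removes T^{-1} but not the sign. The solution u enters as an
  arbitrary one in the ball, and its uniqueness is proved along the way.\<close>

theorem theorem1p8:
  fixes g :: "real^'n \<Rightarrow> real \<Rightarrow> real^'n \<Rightarrow> real"
    and u :: "real^'n \<Rightarrow> real"
    and \<G> :: "(real^'n \<Rightarrow> real^'n) set"
    and k C Q \<epsilon> :: real
  assumes n: "CARD('n) \<ge> 3"
    and k: "0 < k" "k < real CARD('n) - 2"
    and C_pos: "C > 0"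
    and C_bound: "\<And>f :: real^'n \<Rightarrow> real. f \<in> E_space (k + 2) \<Longrightarrow>
           newton_potential f \<in> F_space k \<and>
           F_norm k (newton_potential f) \<le> ennreal C * E_norm (k + 2) f"
    and Q: "Q = 1 / (2 * C)"
    and H1: "\<And>x. C1_on (UNIV - {(0, 0)}) (\<lambda>(z, p). g x z p)"
            "\<And>x. continuous_on UNIV (\<lambda>(z, p). g x z p)"
    and H2: "(\<lambda>x. g x 0 0) \<in> E_space (k + 2)"
    and H3: "\<exists>\<delta>>0. grad_zp_sup k g \<delta> < \<infinity>"
    and eps: "\<epsilon> > 0"
    and eps_grad: "grad_zp_sup k g \<epsilon> < ennreal Q"
    and eps_zero: "E_norm (k + 2) (\<lambda>x. g x 0 0) \<le> ennreal (\<epsilon> * Q)"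
    and u: "u \<in> F_space k" "F_norm k u \<le> ennreal \<epsilon>"
           "\<And>x. u x = newton_potential (\<lambda>y. g y (u y) (gradient u y)) x"
    and G: "\<And>T. T \<in> \<G> \<Longrightarrow> orthogonal_transformation T"
  shows
    "((\<forall>T\<in>\<G>. \<forall>x z p. g (T x) z p = g x z p) \<and>
      (\<forall>T\<in>\<G>. \<forall>x z p. g x z (T p) = g x z p)
        \<longrightarrow> (\<forall>T\<in>\<G>. \<forall>x. u x = u (T x))) \<and>
     (\<G> \<noteq> {} \<and> (\<forall>T\<in>\<G>. \<forall>x z p. g x z (T p) = - g x z p)
        \<longrightarrow> (\<forall>x. u x = 0)) \<and>
     ((\<forall>T\<in>\<G>. \<forall>x z p. g (T x) z p = - g x z p) \<and>
      (\<forall>x z p. g x z p = g x (- z) p) \<and>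
      (\<forall>x z p. g x z p = g x z (- p)) \<and>
      (\<forall>T\<in>\<G>. \<forall>x z p. g x z (T p) = g x z p)
        \<longrightarrow> (\<forall>T\<in>\<G>. \<forall>x. u x = - u (T x)))"
proof -
  obtain m where m: "0 \<le> m" "grad_zp_sup k g \<epsilon> = ennreal m"
    using eps_grad by (cases "grad_zp_sup k g \<epsilon>") auto
  then have "m < Q" using eps_grad by (simp add: ennreal_less_iff)
  then have "C * m < C * Q" using C_pos by simp
  also have "C * Q < 1" using C_pos by (simp add: Q)
  finally have "C * m < 1" .
  interpret newton_equation g k C m \<epsilon>
  proof
    show "F_norm k (newton_potential f) \<le> ennreal C * E_norm (k + 2) f"
      if "f \<in> E_space (k + 2)" for f :: "real^'n \<Rightarrow> real"
      using C_bound[OF that] by (rule conjunct2)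
    show "C1_on (UNIV - {(0, 0)}) (\<lambda>(z, p). g x z p)" for x by (rule H1(1))
    show "continuous_on UNIV (\<lambda>(z, p). g x z p)" for x by (rule H1(2))
    show "(\<lambda>x. g x 0 0) \<in> E_space (k + 2)" by (rule H2)
    show "C * m < 1" by fact
    show "grad_zp_sup k g \<epsilon> \<le> ennreal m" by (rule eq_refl[OF m(2)])
  qed (use n k(1) C_pos m(1) eps in simp_all)
  have "u x = newton_potential (source u) x" for x
    unfolding source_def by (rule u(3))
  then have sol: "solution u" using u(2) unfolding solution_def by blast
  have T_inv: "T (inv T p) = p" if "T \<in> \<G>" for T p
    using G[OF that] by (simp add: orthogonal_transformation_surj surj_f_inv_f)
  show ?thesis
  proof (intro conjI impI ballI allI; (elim conjE)?)
    fix T x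
    assume T: "T \<in> \<G>" and gx: "\<forall>T\<in>\<G>. \<forall>x z p. g (T x) z p = g x z p"
      and gp: "\<forall>T\<in>\<G>. \<forall>x z p. g x z (T p) = g x z p"
    \<comment> \<open>Symmetry in p is applied at \<open>inv T p\<close>, which stands in for
      symmetry under the inverse: \<G> is only a set and may lack it.\<close>
    have "g x z (inv T p) = g (T x) z p" for x z p
      using gx gp T T_inv by metis
    then show "u x = u (T x)"
      using solution_transform[OF sol G[OF T], of 1 x] by simp
  next
    fix x
    assume "\<G> \<noteq> {}" and gp: "\<forall>T\<in>\<G>. \<forall>x z p. g x z (T p) = - g x z p"
    then obtain T where T: "T \<in> \<G>" by blast
    have "T 0 = 0" using G[OF T] linear_0 orthogonal_transformation_linear by blast
    then have "g x 0 0 = - g x 0 0" for x using gp T by metis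
    then have "g x 0 0 = 0" for x by simp
    then have "solution (\<lambda>_. 0)"
      by (simp add: solution_def F_norm_zero source_zero newton_potential_def)
    from solution_unique[OF sol this] show "u x = 0" by simp
  next
    fix T x
    assume T: "T \<in> \<G>" and gx: "\<forall>T\<in>\<G>. \<forall>x z p. g (T x) z p = - g x z p"
      and gz: "\<forall>x z p. g x z p = g x (- z) p" and ge: "\<forall>x z p. g x z p = g x z (- p)"
      and gp: "\<forall>T\<in>\<G>. \<forall>x z p. g x z (T p) = g x z p"
    have "g x (- z) (- inv T p) = - g (T x) z p" for x z p
    proof -
      \<comment> \<open>Both signs are removed before \<open>T\<close> is dealt with; the remaining
        minus sign comes from antisymmetry in x.\<close>
      have "g x (- z) (- inv T p) = g x z (inv T p)" using gz ge by metis
      also have "\<dots> = g x z p" using gp T T_inv by metis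
      finally show ?thesis using gx T by simp
    qed
    then show "u x = - u (T x)"
      using solution_transform[OF sol G[OF T], of "-1" x] by simp
  qed
qed

end
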